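(* Let $m\ge n$, let $\sigma_1\ge\cdots\ge\sigma_n\ge 0$ and $d_1\ge\cdots\ge d_n\ge 0$ be real numbers, and define $$\mathcal{M}=\{U\Sigma V^\top : U\in\mathcal{O}(m),\ V\in\mathcal{O}(n)\},\qquad \Sigma=\mathrm{diag}(\sigma_1,\ldots,\sigma_n)\in\mathbb{R}^{m\times n},$$ $$\mathcal{D}=\{X\in\mathbb{R}^{m\times n} : X_{ii}=d_i,\ 1\le i\le n\},\qquad \mathcal{P}=\{X\in\mathbb{R}^{m\times n} : X_{ij}\ge 0\ \text{for all } i,j\}.$$ Suppose that $(x_i)_{i\ge 0}$ is a sequence of successive projections onto the compact set $\mathcal{M}$, i.e. $x_0\in\mathcal{M}$ and, for each $i\ge 0$, $x_{i+1}$ is a projection onto $\mathcal{M}$ of $P_{\mathcal{D}\cap\mathcal{P}}(x_i)$. Then there is a limit point $x$ of the sequence $(x_i)$ that satisfies $$\|x-P_{\mathcal{D}\cap\mathcal{P}}(x)\|=\lim_{i\to\infty}\|x_i-P_{\mathcal{D}\cap\mathcal{P}}(x_i)\|.$$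
   Context: $\mathcal{O}(k)$ denotes the group of real orthogonal $k\times k$ matrices. For $m\ge n$, $\mathrm{diag}(s_1,\ldots,s_n)\in\mathbb{R}^{m\times n}$ has $(i,i)$ entry $s_i$ for $1\le i\le n$ and all other entries zero. $\|\cdot\|$ is the Frobenius norm on $\mathbb{R}^{m\times n}$. A projection of a matrix $Y$ onto a closed set $C$ is an element of $C$ at minimal Frobenius distance from $Y$ (it need not be unique for $C=\mathcal{M}$); $P_{\mathcal{D}\cap\mathcal{P}}(Y)$ is the projection of $Y$ onto the nonempty closed convex set $\mathcal{D}\cap\mathcal{P}$, which is unique. A limit point of a sequence is the limit of some convergent subsequence. *)

theory Defs
  imports "HOL-Analysis.Analysis"
begin

text \<open>
  An \<open>m \<times> n\<close> real matrix is an element of \<^typ>\<open>real ^ 'n ^ 'm\<close> with \<open>m = CARD('m)\<close> and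
  \<open>n = CARD('n)\<close>.  Index types carry no order, so the position of a row or column is given by an
  arbitrary numbering \<open>\<rho> :: 'm \<Rightarrow> nat\<close> of the rows by \<open>1, \<dots>, m\<close> and \<open>\<gamma> :: 'n \<Rightarrow> nat\<close> of the
  columns by \<open>1, \<dots>, n\<close>.  The entry of \<open>X\<close> in row \<open>a\<close> and column \<open>b\<close> is the \<open>(i,i)\<close> entry iff
  \<open>\<rho> a = i\<close> and \<open>\<gamma> b = i\<close>.
\<close>

definition numbering :: "('a::finite \<Rightarrow> nat) \<Rightarrow> bool" where
  "numbering \<rho> \<longleftrightarrow> bij_betw \<rho> UNIV {1..CARD('a)}"

definition diag_matrix ::
    "('m::finite \<Rightarrow> nat) \<Rightarrow> ('n::finite \<Rightarrow> nat) \<Rightarrow> (nat \<Rightarrow> real) \<Rightarrow> real ^ 'n ^ 'm" where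
  "diag_matrix \<rho> \<gamma> s = (\<chi> a b. if \<rho> a = \<gamma> b then s (\<gamma> b) else 0)"

definition prescribed_singular_values ::
    "('m::finite \<Rightarrow> nat) \<Rightarrow> ('n::finite \<Rightarrow> nat) \<Rightarrow> (nat \<Rightarrow> real) \<Rightarrow> (real ^ 'n ^ 'm) set" where
  "prescribed_singular_values \<rho> \<gamma> \<sigma> =
     {U ** diag_matrix \<rho> \<gamma> \<sigma> ** transpose V | (U :: real ^ 'm ^ 'm) (V :: real ^ 'n ^ 'n).
        orthogonal_matrix U \<and> orthogonal_matrix V}"

definition prescribed_diagonal ::
    "('m::finite \<Rightarrow> nat) \<Rightarrow> ('n::finite \<Rightarrow> nat) \<Rightarrow> (nat \<Rightarrow> real) \<Rightarrow> (real ^ 'n ^ 'm) set" where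
  "prescribed_diagonal \<rho> \<gamma> d =
     {X. \<forall>i\<in>{1..CARD('n)}. \<forall>a b. \<rho> a = i \<and> \<gamma> b = i \<longrightarrow> X $ a $ b = d i}"

definition nonneg_matrices :: "(real ^ 'n::finite ^ 'm::finite) set" where
  "nonneg_matrices = {X. \<forall>a b. X $ a $ b \<ge> 0}"

lemma norm_eq_Frobenius:
  fixes X :: "real ^ 'n::finite ^ 'm::finite"
  shows "norm X = sqrt (\<Sum>a\<in>UNIV. \<Sum>b\<in>UNIV. (X $ a $ b)\<^sup>2)"
  by (simp add: norm_vec_def L2_set_def sum_nonneg)

text \<open>
  For nonconvex \<open>C\<close> there may be several projections, hence a relation.  For closed convex
  nonempty sets the projection is unique and equals the library function \<^const>\<open>closest_point\<close>.
\<close>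

definition is_projection :: "'a::real_normed_vector set \<Rightarrow> 'a \<Rightarrow> 'a \<Rightarrow> bool" where
  "is_projection C Y Z \<longleftrightarrow> Z \<in> C \<and> (\<forall>W\<in>C. norm (Y - Z) \<le> norm (Y - W))"

lemma is_projection_iff_closest_point:
  fixes C :: "'a::euclidean_space set"
  assumes "closed C" "convex C" "C \<noteq> {}"
  shows "is_projection C Y Z \<longleftrightarrow> Z = closest_point C Y"
  using closest_point_exists[OF assms(1,3), of Y] closest_point_unique[OF assms(2,1), of Z Y]
  by (auto simp: is_projection_def dist_norm)

end

theory Submission
  imports Defs
begin

text \<open>
  Each half-step of alternating projections cannot increase the distance, so the gaps decrease to
  a limit.  As \<open>\<M>\<close> lies on a sphere, a subsequence of the iterates converges, and continuity of
  the convex projection transports the limit of the gaps to the limit point.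
\<close>

lemma norm_transpose:
  fixes A :: "real ^ 'n::finite ^ 'm::finite"
  shows "norm (transpose A) = norm A"
  unfolding norm_eq_Frobenius transpose_def by (simp, subst sum.swap, rule refl)

text \<open>Right multiplication by \<open>Q\<close> acts on each row of \<open>A\<close> as the
  isometry given by \<open>transpose Q\<close>, and the Frobenius norm depends only on the norms of
  the rows.\<close>

lemma norm_mult_orthogonal_matrix_right:
  fixes A :: "real ^ 'n::finite ^ 'm::finite" and Q :: "real ^ 'n ^ 'n"
  assumes "orthogonal_matrix Q"
  shows "norm (A ** Q) = norm A"
proof -
  have "orthogonal_transformation ((*v) (transpose Q))"
    using assms by (simp add: orthogonal_transformation_matrix orthogonal_matrix_transpose)
  moreover have "(A ** Q) $ a = transpose Q *v (A $ a)" for a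
    by (simp add: vec_eq_iff matrix_matrix_mult_def matrix_vector_mult_def transpose_def mult.commute)
  ultimately have "norm ((A ** Q) $ a) = norm (A $ a)" for a
    by (metis orthogonal_transformation_norm)
  then show ?thesis
    by (simp add: norm_vec_def)
qed

lemma norm_mult_orthogonal_matrix_left:
  fixes A :: "real ^ 'n::finite ^ 'm::finite" and Q :: "real ^ 'm ^ 'm"
  assumes "orthogonal_matrix Q"
  shows "norm (Q ** A) = norm A"
proof -
  have "norm (Q ** A) = norm (transpose A ** transpose Q)"
    by (metis matrix_transpose_mul norm_transpose)
  also have "\<dots> = norm A"
    using assms
    by (simp add: norm_mult_orthogonal_matrix_right norm_transpose orthogonal_matrix_transpose)
  finally show ?thesis .
qed

text \<open>By orthogonal invariance all these matrices have the Frobenius norm of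
  \<open>diag_matrix \<rho> \<gamma> \<sigma>\<close>.\<close>

lemma bounded_prescribed_singular_values:
  "bounded (prescribed_singular_values \<rho> \<gamma> \<sigma>)"
proof -
  have "norm X \<le> norm (diag_matrix \<rho> \<gamma> \<sigma>)" if "X \<in> prescribed_singular_values \<rho> \<gamma> \<sigma>" for X
    using that
    by (auto simp: prescribed_singular_values_def norm_mult_orthogonal_matrix_left
        norm_mult_orthogonal_matrix_right orthogonal_matrix_transpose)
  then show ?thesis
    by (auto simp: bounded_iff)
qed

lemma closed_prescribed_diagonal: "closed (prescribed_diagonal \<rho> \<gamma> d)"
  unfolding prescribed_diagonal_def Ball_def
  \<comment> \<open>An implication defines a closed set when its premise is an open condition; here
    the premises do not mention \<open>X\<close>, so \<open>open_Collect_const\<close>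
    applies.\<close>
  by (intro closed_Collect_all closed_Collect_imp closed_Collect_eq
      open_Collect_const continuous_intros)

lemma convex_prescribed_diagonal: "convex (prescribed_diagonal \<rho> \<gamma> d)"
  \<comment> \<open>Factoring out \<open>d i\<close> leaves the sum of the convex weights, which is
    1.\<close>
  by (auto simp: convex_def prescribed_diagonal_def simp flip: distrib_right)

lemma closed_nonneg_matrices: "closed nonneg_matrices"
  unfolding nonneg_matrices_def
  by (intro closed_Collect_all closed_Collect_le continuous_intros)

lemma convex_nonneg_matrices: "convex nonneg_matrices"
  by (auto simp: convex_def nonneg_matrices_def)

text \<open>Together with the next lemma, this provides the witness that \<open>D \<inter> P\<close>
  is nonempty.\<close>

lemma diag_matrix_in_prescribed_diagonal: "diag_matrix \<rho> \<gamma> d \<in> prescribed_diagonal \<rho> \<gamma> d"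
  by (auto simp: prescribed_diagonal_def diag_matrix_def)

lemma diag_matrix_in_nonneg_matrices:
  assumes "\<And>b. d (\<gamma> b) \<ge> 0"
  shows "diag_matrix \<rho> \<gamma> d \<in> nonneg_matrices"
  using assms by (auto simp: nonneg_matrices_def diag_matrix_def)

lemma alternating_projections_gap_limit:
  fixes M C :: "'a::euclidean_space set" and x :: "nat \<Rightarrow> 'a"
  assumes "bounded M" and C: "closed C" "convex C" "C \<noteq> {}"
    and "x 0 \<in> M"
    and proj: "\<And>i. is_projection M (closest_point C (x i)) (x (Suc i))"
  shows "\<exists>l. (\<exists>r :: nat \<Rightarrow> nat. strict_mono r \<and> (x \<circ> r) \<longlonglongrightarrow> l) \<and>
           (\<lambda>i. norm (x i - closest_point C (x i))) \<longlonglongrightarrow> norm (l - closest_point C l)"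
proof -
  define p where "p = closest_point C"
  define g where "g y = norm (y - p y)" for y
  have xM: "x i \<in> M" for i
    using \<open>x 0 \<in> M\<close> proj by (cases i) (auto simp: is_projection_def)
  have "g (x (Suc i)) \<le> g (x i)" for i
  proof -
    \<comment> \<open>\<open>p (x i)\<close> lies in \<open>C\<close>, so it competes with the point
      of \<open>C\<close> closest to \<open>x (Suc i)\<close>.\<close>
    have "g (x (Suc i)) \<le> norm (x (Suc i) - p (x i))"
      using closest_point_le[OF C(1) closest_point_in_set[OF C(1,3)]]
      by (simp add: g_def p_def dist_norm)
    \<comment> \<open>Symmetrically, \<open>x i\<close> lies in \<open>M\<close> and competes with
      \<open>x (Suc i)\<close> in the projection of \<open>p (x i)\<close> onto
      \<open>M\<close>.\<close>
    also have "\<dots> \<le> g (x i)"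
      using proj[of i] xM[of i] by (simp add: is_projection_def g_def p_def norm_minus_commute)
    finally show ?thesis .
  qed
  then have "decseq (g \<circ> x)"
    by (simp add: decseq_Suc_iff)
  moreover have "0 \<le> (g \<circ> x) i" for i
    by (simp add: g_def)
  ultimately obtain L where L: "(g \<circ> x) \<longlonglongrightarrow> L"
    using decseq_convergent[of "g \<circ> x" 0] by blast
  have "bounded (range x)"
    using \<open>bounded M\<close> xM by (auto intro: bounded_subset)
  then obtain l r where r: "strict_mono (r :: nat \<Rightarrow> nat)" and lim: "(x \<circ> r) \<longlonglongrightarrow> l"
    using bounded_imp_convergent_subsequence by blast
  \<comment> \<open>Convexity of \<open>C\<close> enters here: it makes the closest-point map
    continuous.\<close>
  have "isCont g l"
    unfolding g_def p_def using continuous_at_closest_point[OF C(2,1,3)]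
    by (intro continuous_intros)
  then have "(g \<circ> (x \<circ> r)) \<longlonglongrightarrow> g l"
    using lim by (simp add: continuous_at_sequentially)
  moreover have "(g \<circ> x \<circ> r) \<longlonglongrightarrow> L"
    using LIMSEQ_subseq_LIMSEQ[OF L r] .
  ultimately have "L = g l"
    by (simp add: comp_assoc LIMSEQ_unique)
  then show ?thesis
    using L r lim by (auto simp: g_def p_def comp_def)
qed

theorem corollary3p8:
  fixes \<rho> :: "'m::finite \<Rightarrow> nat" and \<gamma> :: "'n::finite \<Rightarrow> nat"
    and \<sigma> d :: "nat \<Rightarrow> real"
    and M D P :: "(real ^ 'n ^ 'm) set"
    and x :: "nat \<Rightarrow> real ^ 'n ^ 'm"
  assumes "CARD('n) \<le> CARD('m)"
    and "numbering \<rho>" and "numbering \<gamma>"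
    and "antimono_on {1..CARD('n)} \<sigma>" and "\<sigma> (CARD('n)) \<ge> 0"
    and "antimono_on {1..CARD('n)} d" and "d (CARD('n)) \<ge> 0"
    and "M = prescribed_singular_values \<rho> \<gamma> \<sigma>"
    and "D = prescribed_diagonal \<rho> \<gamma> d"
    and "P = nonneg_matrices"
    and "x 0 \<in> M"
    and "\<And>i. is_projection M (closest_point (D \<inter> P) (x i)) (x (Suc i))"
  shows "\<exists>l. (\<exists>r :: nat \<Rightarrow> nat. strict_mono r \<and> (x \<circ> r) \<longlonglongrightarrow> l) \<and>
           (\<lambda>i. norm (x i - closest_point (D \<inter> P) (x i)))
             \<longlonglongrightarrow> norm (l - closest_point (D \<inter> P) l)"
proof (rule alternating_projections_gap_limit)
  \<comment> \<open>As \<open>d\<close> is decreasing on the index range, its last value, assumed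
    nonnegative, bounds all the others from below.\<close>
  have "d (\<gamma> b) \<ge> 0" for b
  proof -
    have "\<gamma> b \<in> {1..CARD('n)}"
      using assms(3) by (auto simp: numbering_def bij_betw_def)
    then have "d (CARD('n)) \<le> d (\<gamma> b)"
      using assms(6) by (intro monotone_onD[OF assms(6)]) auto
    with assms(7) show ?thesis
      by simp
  qed
  then show "D \<inter> P \<noteq> {}"
    using diag_matrix_in_prescribed_diagonal diag_matrix_in_nonneg_matrices
    unfolding assms(9,10) by blast
  show "closed (D \<inter> P)" "convex (D \<inter> P)"
    unfolding assms(9,10)
    by (intro closed_Int closed_prescribed_diagonal closed_nonneg_matrices
        convex_Int convex_prescribed_diagonal convex_nonneg_matrices)+
  show "bounded M"
    unfolding assms(8) by (rule bounded_prescribed_singular_values)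
qed (fact assms)+

end
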